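(* Let $x,u,v,y,Z_L,Z_R$ be the operators in the boson realization described in the context, and put $$a=x-g\,vZ_L,\qquad b=u-g\,xZ_R-g\,yZ_L+g^2\,vZ_LZ_R,\qquad c=v,\qquad d=y-g\,vZ_R .$$ Then $a,b,c,d$ satisfy the commutation relations of the two-parametric Jordanian quantum group $GL_{h,g}(2)$, namely, with $D'=ad-bc-(h+g)ac$, $$[a,b]=-(h+g)(D'-a^2),\qquad[a,c]=-(h-g)c^2,\qquad[a,d]=(h+g)ac-(h-g)dc,$$ $$[b,c]=-(h+g)ac-(h-g)cd,\qquad[b,d]=(h-g)(D'-d^2),\qquad[c,d]=(h+g)c^2 .$$
   Context: Boson operators: $[\bar a_i^j,a_k^\ell]=\delta_{i,k}\delta^{j,\ell}$, $[a_i^j,a_k^\ell]=[\bar a_i^j,\bar a_k^\ell]=0$ for $i,j,k,\ell\in\{1,2\}$. Put $E_{ij}=a_i^1\bar a_j^1+a_i^2\bar a_j^2$, $E^{ij}=a_1^i\bar a_1^j+a_2^i\bar a_2^j$, and $$J_+=E_{21},\quad K_+=E^{12},\quad Z_L=-E_{11}-E_{22},\quad Z_R=E^{11}+E^{22}$$ (so that $Z_L=-Z_R$ in this realization). With $h,g$ the deformation parameters, $\sigma_L=-\ln(1-2hJ_+)$ and $\sigma_R=-\ln(1-2hK_+)$ (formal power series in $h$), and $$x=a_1^1e^{(-\sigma_L+\sigma_R)/2},\quad u=a_1^2e^{-(\sigma_L+\sigma_R)/2},\quad v=a_2^1e^{(\sigma_L+\sigma_R)/2},\quad y=a_2^2e^{(\sigma_L-\sigma_R)/2}.$$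 *)

theory Defs
  imports Complex_Main "HOL-Computational_Algebra.Formal_Power_Series"
begin

definition commutator :: "'a::ring \<Rightarrow> 'a \<Rightarrow> 'a" where
  "commutator p q = p * q - q * p"

text \<open>
  The boson operators are elements of an arbitrary (noncommutative) unital algebra:
  \<open>cr i j\<close> stands for $a_i^j$ and \<open>an i j\<close> for $\bar a_i^j$.
  Only the indices 1 and 2 are relevant.
\<close>

definition boson_operators ::
  "(nat \<Rightarrow> nat \<Rightarrow> 'a::ring_1) \<Rightarrow> (nat \<Rightarrow> nat \<Rightarrow> 'a) \<Rightarrow> bool" where
  "boson_operators cr an \<longleftrightarrow>
     (\<forall>i\<in>{1,2}. \<forall>j\<in>{1,2}. \<forall>k\<in>{1,2}. \<forall>l\<in>{1,2}.
        commutator (an i j) (cr k l) = of_bool (i = k) * of_bool (j = l) \<and>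
        commutator (cr i j) (cr k l) = 0 \<and>
        commutator (an i j) (an k l) = 0)"

context
  fixes cr an :: "nat \<Rightarrow> nat \<Rightarrow> 'a::ring_1"
begin

definition E_lower :: "nat \<Rightarrow> nat \<Rightarrow> 'a" where
  "E_lower i j = cr i 1 * an j 1 + cr i 2 * an j 2"

definition E_upper :: "nat \<Rightarrow> nat \<Rightarrow> 'a" where
  "E_upper i j = cr 1 i * an 1 j + cr 2 i * an 2 j"

definition J_plus :: 'a where "J_plus = E_lower 2 1"
definition K_plus :: 'a where "K_plus = E_upper 1 2"
definition Z_L :: 'a where "Z_L = - E_lower 1 1 - E_lower 2 2"
definition Z_R :: 'a where "Z_R = E_upper 1 1 + E_upper 2 2"

end

text \<open>
  Everything below lives in \<open>'a fps\<close>, the power series in the formal parameter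
  $h$ = \<open>fps_X\<close>, which is central, over the algebra of the boson operators.
  The exponential and the logarithm are obtained by substitution into the real power series
  \<open>fps_exp 1\<close>, i.e. $e^X$, and \<open>fps_ln 1\<close>, i.e. $\ln(1+X)$.
  \<open>nc_exp f\<close> is meaningful only if \<open>f\<close> has constant term 0, and
  \<open>nc_ln f\<close> only if \<open>f\<close> has constant term 1.
\<close>

definition fps_lift :: "real fps \<Rightarrow> 'a::real_algebra_1 fps" where
  "fps_lift F = Abs_fps (\<lambda>n. of_real (fps_nth F n))"

definition nc_exp :: "'a::real_algebra_1 fps \<Rightarrow> 'a fps" where
  "nc_exp f = fps_compose (fps_lift (fps_exp 1)) f"

definition nc_ln :: "'a::real_algebra_1 fps \<Rightarrow> 'a fps" where
  "nc_ln f = fps_compose (fps_lift (fps_ln 1)) (f - 1)"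

definition half :: "'a::real_algebra_1 fps \<Rightarrow> 'a fps" where
  "half f = fps_const (of_real (1 / 2)) * f"

context
  fixes cr an :: "nat \<Rightarrow> nat \<Rightarrow> 'a::real_algebra_1"
begin

definition sigma_L :: "'a fps" where
  "sigma_L = - nc_ln (1 - 2 * fps_X * fps_const (J_plus cr an))"

definition sigma_R :: "'a fps" where
  "sigma_R = - nc_ln (1 - 2 * fps_X * fps_const (K_plus cr an))"

definition x_op :: "'a fps" where
  "x_op = fps_const (cr 1 1) * nc_exp (half (- sigma_L + sigma_R))"

definition u_op :: "'a fps" where
  "u_op = fps_const (cr 1 2) * nc_exp (- half (sigma_L + sigma_R))"

definition v_op :: "'a fps" where
  "v_op = fps_const (cr 2 1) * nc_exp (half (sigma_L + sigma_R))"

definition y_op :: "'a fps" where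
  "y_op = fps_const (cr 2 2) * nc_exp (half (sigma_L - sigma_R))"

end

end

theory Submission
  imports Defs
begin

text \<open>
  The matrix \<open>(x, u; v, y)\<close> is the matrix \<open>(A11, A12; A21, A22)\<close> of the four commuting
  creation operators, dressed with \<open>P = e^(\<sigma>_L/2)\<close> and \<open>Q = e^(\<sigma>_R/2)\<close>. Since
  \<open>\<sigma>_L = -ln (1 - 2 h J)\<close>, one has \<open>P = (1 - 2 h J)^(-1/2)\<close>, a power series in \<open>h J\<close>; likewise
  \<open>Q = (1 - 2 h K)^(-1/2)\<close>. The operators \<open>J = J_+\<close> and \<open>K = K_+\<close> commute, being raising operators of
  two commuting copies of \<open>gl(2)\<close>: \<open>J\<close> acts on the lower index of the creation operators and \<open>K\<close> on
  the upper one. Every statement about \<open>P\<close> and \<open>Q\<close> reduces to one principle: if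
  \<open>J A = A J + B\<close> with \<open>B\<close> commuting with \<open>J\<close>, then \<open>[F(h J), A] = h F'(h J) B\<close>
  (\<open>series_at_commutator\<close>). With \<open>F = (1 - 2 t)^(-1/2)\<close>, for which \<open>F' = F^3\<close> and
  \<open>(1/F)' = -F\<close>, it yields
  \[ P A_{1j} = A_{1j} P + h P^3 A_{2j}, \qquad P^{-1} A_{1j} = A_{1j} P^{-1} - h P A_{2j}, \]
  and the analogous rules for \<open>Q\<close>. Pushing all dressing factors to the right then shows that
  \<open>x, u, v, y\<close> satisfy the one-parameter relations, those with \<open>g = 0\<close>
  (\<open>jordanian_relations_dressed\<close>); their quantum determinant is just the ordinary determinant
  \<open>A11 A22 - A12 A21\<close>, since all dressing factors cancel in it.
\<close>

text \<open>
  The parameter \<open>g\<close> enters through a similarity transformation. With \<open>N = Z_R = - Z_L\<close>, the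
  number operator, \<open>a, b, c, d\<close> are the entries of
  \[ \pmatrix{ 1 & g N \cr 0 & 1 }
     \pmatrix{ x & u \cr v & y }
     \pmatrix{ 1 & - g N \cr 0 & 1 } \]
  with every \<open>N\<close> written to the right. Each of \<open>x, u, v, y\<close> creates exactly one boson
  (\<open>J\<close> and \<open>K\<close> conserve the number), so that \<open>[N, x] = x\<close> and so on. These commutators turn the
  structure constants \<open>h\<close> into \<open>h + g\<close> and \<open>h - g\<close>; for instance
  \<open>[a, c] = [x, v] + g v [N, v] = - h c^2 + g c^2\<close>
  (\<open>jordanian_relations_twist\<close>).
\<close>

unbundle fps_syntax

section \<open>Real power series in \<open>h J\<close>\<close>

text \<open>
  The series \<open>F(h J)\<close>. The map \<open>F \<mapsto> F(h J)\<close> is a unital ring homomorphism from a commutative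
  ring, which lets identities between functions of \<open>h J\<close> be proved for real power series.
\<close>

definition series_at :: "'a::real_algebra_1 \<Rightarrow> real fps \<Rightarrow> 'a fps" where
  "series_at J F = Abs_fps (\<lambda>n. of_real (fps_nth F n) * J ^ n)"

lemma series_at_nth [simp]: "series_at J F $ n = of_real (F $ n) * J ^ n"
  by (simp add: series_at_def)

lemma of_real_comm: "p * of_real r = of_real r * (p :: 'a::real_algebra_1)"
  by (simp add: of_real_def)

lemma of_real_left_comm: "p * (of_real r * q) = of_real r * (p * q :: 'a::real_algebra_1)"
  by (simp add: of_real_def)

lemma series_at_mult: "series_at J (F * G) = series_at J F * series_at J G"
proof (rule fps_ext)
  fix n
  have "of_real (F $ i * G $ (n - i)) * J ^ n
      = (of_real (F $ i) * J ^ i) * (of_real (G $ (n - i)) * J ^ (n - i))"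
    if "i \<le> n" for i
    using that by (simp add: mult.assoc of_real_left_comm[of "J ^ i"] flip: power_add)
  then show "series_at J (F * G) $ n = (series_at J F * series_at J G) $ n"
    by (simp add: fps_mult_nth sum_distrib_right)
qed

lemma series_at_1 [simp]: "series_at J 1 = 1"
  by (rule fps_ext) simp

lemma series_at_power: "series_at J (F ^ n) = series_at J F ^ n"
  by (induction n) (simp_all add: series_at_mult)

lemma series_at_minus: "series_at J (- F) = - series_at J F"
  by (rule fps_ext) simp

lemma compose_series_at:
  "fps_compose (fps_lift F) (series_at J G) = series_at J (F oo G)"
  by (rule fps_ext)
    (simp add: fps_compose_nth fps_lift_def sum_distrib_right mult.assoc flip: series_at_power)

lemma series_at_commute:
  assumes "J * K = K * J"
  shows "series_at J F * series_at K G = series_at K G * series_at J F"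
proof (rule fps_ext)
  fix n
  have JK: "J ^ i * K ^ j = K ^ j * J ^ i" for i j
    using assms by (metis power_commuting_commutes)
  have "(series_at J F * series_at K G) $ n
      = (\<Sum>i=0..n. (of_real (F $ i) * J ^ i) * (of_real (G $ (n - i)) * K ^ (n - i)))"
    by (simp add: fps_mult_nth)
  also have "\<dots> = (\<Sum>i=0..n. (of_real (G $ (n - i)) * K ^ (n - i)) * (of_real (F $ i) * J ^ i))"
    by (intro sum.cong refl) (metis JK mult.assoc of_real_comm)
  also have "\<dots> = (\<Sum>i=0..n. (of_real (G $ i) * K ^ i) * (of_real (F $ (n - i)) * J ^ (n - i)))"
    by (subst sum.atLeastAtMost_rev) simp
  finally show "(series_at J F * series_at K G) $ n = (series_at K G * series_at J F) $ n"
    by (simp add: fps_mult_nth)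
qed

lemma power_commutator:
  fixes J A B :: "'a::ring_1"
  assumes "J * A = A * J + B" "J * B = B * J"
  shows "J ^ n * A = A * J ^ n + of_nat n * J ^ (n - 1) * B"
proof (induction n)
  case (Suc n)
  have "J ^ Suc n * A = J ^ n * (A * J + B)"
    by (simp add: power_Suc2 mult.assoc assms del: power_Suc)
  also have "\<dots> = A * J ^ Suc n + of_nat n * (J ^ (n - 1) * B * J) + J ^ n * B"
    by (simp add: distrib_left Suc.IH distrib_right power_Suc2 del: power_Suc flip: mult.assoc)
  also have "of_nat n * (J ^ (n - 1) * B * J) = of_nat n * (J ^ n * B)"
    by (cases n) (simp_all add: mult.assoc power_Suc2 del: power_Suc flip: assms(2))
  finally show ?case by (simp add: algebra_simps)
qed simp

text \<open>
  \<open>J\<close> acts on \<open>A\<close> as a derivation whose second iterate vanishes, so the commutator with a function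
  of \<open>h J\<close> stops at the first derivative. The factor \<open>h\<close> is the inner derivative of \<open>F(h J)\<close>.
\<close>

lemma series_at_commutator:
  assumes "J * A = A * J + B" "J * B = B * J"
  shows "series_at J F * fps_const A
    = fps_const A * series_at J F + fps_X * series_at J (fps_deriv F) * fps_const B"
proof (rule fps_ext)
  fix n
  show "(series_at J F * fps_const A) $ n
    = (fps_const A * series_at J F + fps_X * series_at J (fps_deriv F) * fps_const B) $ n"
  proof (cases n)
    case 0
    then show ?thesis by (simp add: of_real_comm)
  next
    case (Suc m)
    then show ?thesis
      by (simp add: mult.assoc power_commutator[OF assms] distrib_left of_real_left_comm[of A]
          of_real_left_comm[of "1 + of_nat m"] del: power_Suc)
  qed
qed

lemma series_at_const_commute:
  assumes "J * B = B * J"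
  shows "series_at J F * fps_const B = fps_const B * series_at J F"
  using series_at_commutator[of J B 0 F] assms by simp

section \<open>The exponential of a sum of commuting power series\<close>

definition exp_term :: "'a::real_algebra_1 fps \<Rightarrow> nat \<Rightarrow> 'a fps" where
  "exp_term f n = fps_const (of_real (1 / fact n)) * f ^ n"

lemma const_real_comm: "f * fps_const (of_real r) = fps_const (of_real r) * (f :: 'a::real_algebra_1 fps)"
  by (rule fps_ext) (simp add: of_real_comm)

lemma of_nat_fps_real: "(of_nat n :: 'a::real_algebra_1 fps) = fps_const (of_real (real n))"
  by (simp only: fps_of_nat of_real_of_nat_eq)

lemma exp_term_Suc: "of_nat (Suc n) * exp_term f (Suc n) = f * exp_term f n"
proof -
  have "of_nat (Suc n) * exp_term f (Suc n)
      = fps_const (of_real (real (Suc n) * (1 / fact (Suc n)))) * f ^ Suc n"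
    by (simp only: exp_term_def of_nat_fps_real fps_const_mult of_real_mult mult.assoc[symmetric])
  also have "real (Suc n) * (1 / fact (Suc n)) = 1 / fact n" by (simp del: of_nat_Suc)
  finally show ?thesis
    by (simp only: exp_term_def power_Suc const_real_comm mult.assoc[symmetric])
qed

lemma exp_term_commute: "f * g = g * f \<Longrightarrow> g * exp_term f n = exp_term f n * g"
  unfolding exp_term_def
  by (metis const_real_comm mult.assoc power_commuting_commutes)

text \<open>
  The binomial theorem for commuting \<open>f\<close> and \<open>g\<close>, divided by \<open>n!\<close>. In this normalisation both sides
  obey the recursion \<open>(n + 1) T_(n+1) = (f + g) T_n\<close>, and no binomial coefficients are needed.
\<close>

lemma exp_term_add:
  assumes "f * g = g * f"
  shows "exp_term (f + g) n = (\<Sum>i\<le>n. exp_term f i * exp_term g (n - i))"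
proof (induction n)
  case 0
  then show ?case by (simp add: exp_term_def)
next
  case (Suc n)
  let ?T = "\<lambda>i. exp_term f i * exp_term g (Suc n - i)"
  have "of_nat (Suc n) * exp_term (f + g) (Suc n)
      = (f + g) * (\<Sum>i\<le>n. exp_term f i * exp_term g (n - i))"
    by (simp only: exp_term_Suc Suc.IH)
  also have "\<dots> = (\<Sum>i\<le>n. (f * exp_term f i) * exp_term g (n - i))
      + (\<Sum>i\<le>n. exp_term f i * (g * exp_term g (n - i)))"
    by (simp only: distrib_right sum_distrib_left sum.distrib exp_term_commute[OF assms]
        mult.assoc[symmetric])
  also have "(\<Sum>i\<le>n. (f * exp_term f i) * exp_term g (n - i)) = (\<Sum>i\<le>Suc n. of_nat i * ?T i)"
    by (simp only: sum.atMost_Suc_shift mult.assoc[symmetric] exp_term_Suc diff_Suc_Suc of_nat_0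
        mult_zero_left add_0_left)
  also have "(\<Sum>i\<le>n. exp_term f i * (g * exp_term g (n - i)))
      = (\<Sum>i\<le>n. of_nat (Suc n - i) * ?T i)"
  proof (intro sum.cong refl)
    fix i assume "i \<in> {..n}"
    then have "Suc n - i = Suc (n - i)" by auto
    then show "exp_term f i * (g * exp_term g (n - i)) = of_nat (Suc n - i) * ?T i"
      by (simp only: exp_term_Suc[symmetric] mult.assoc[symmetric]
          mult_of_nat_commute[of _ "exp_term f i"])
  qed
  \<comment> \<open>The added term \<open>i = n + 1\<close> has weight 0, as the term \<open>i = 0\<close> had in the first sum.\<close>
  also have "\<dots> = (\<Sum>i\<le>Suc n. of_nat (Suc n - i) * ?T i)"
    by simp
  also have "(\<Sum>i\<le>Suc n. of_nat i * ?T i) + (\<Sum>i\<le>Suc n. of_nat (Suc n - i) * ?T i)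
      = (\<Sum>i\<le>Suc n. of_nat (Suc n) * ?T i)"
    by (auto intro!: sum.cong simp only: sum.distrib[symmetric] distrib_right[symmetric]
        of_nat_add[symmetric] atMost_iff le_add_diff_inverse)
  also have "\<dots> = of_nat (Suc n) * (\<Sum>i\<le>Suc n. ?T i)"
    by (simp only: sum_distrib_left)
  finally have eq: "of_nat (Suc n) * exp_term (f + g) (Suc n) = of_nat (Suc n) * (\<Sum>i\<le>Suc n. ?T i)" .
  \<comment> \<open>Over a real algebra the factor \<open>n + 1\<close> can be cancelled.\<close>
  have inv: "fps_const (of_real (1 / real (Suc n))) * (of_nat (Suc n) * p) = p" for p :: "'a fps"
    by (simp only: of_nat_fps_real mult.assoc[symmetric] fps_const_mult of_real_mult[symmetric]) simp
  show ?case using inv[of "exp_term (f + g) (Suc n)"] inv[of "\<Sum>i\<le>Suc n. ?T i"] eq by metis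
qed

lemma nth_power_0:
  fixes f :: "'a::ring_1 fps"
  assumes "f $ 0 = 0" "n < i"
  shows "(f ^ i) $ n = 0"
  using assms startsby_zero_power_prefix by blast

text \<open>
  A fixed upper bound \<open>m\<close> serves all coefficients up to \<open>m\<close> at once, which turns products of
  exponentials into finite double sums.
\<close>

lemma nc_exp_nth:
  assumes "f $ 0 = 0" "n \<le> m"
  shows "nc_exp f $ n = (\<Sum>i\<le>m. exp_term f i $ n)"
proof -
  have "nc_exp f $ n = (\<Sum>i\<le>n. exp_term f i $ n)"
    by (simp add: nc_exp_def fps_compose_nth fps_lift_def exp_term_def atLeast0AtMost)
  also have "\<dots> = (\<Sum>i\<le>m. exp_term f i $ n)"
    using assms by (intro sum.mono_neutral_left) (auto simp: exp_term_def nth_power_0)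
  finally show ?thesis .
qed

lemma nth_mult_0:
  fixes p q :: "'a::ring_1 fps"
  assumes "\<And>k. k < i \<Longrightarrow> p $ k = 0" "\<And>k. k < j \<Longrightarrow> q $ k = 0" "n < i + j"
  shows "(p * q) $ n = 0"
  unfolding fps_mult_nth
proof (intro sum.neutral ballI)
  fix k assume "k \<in> {0..n}"
  with assms(3) have "k < i \<or> n - k < j" by auto
  with assms(1,2) show "p $ k * q $ (n - k) = 0" by auto
qed

text \<open>
  Functional equation of the exponential: in the coefficient of \<open>h^n\<close>, only the products of terms
  of degrees \<open>i + j \<le> n\<close> survive, and these are grouped by their total degree.
\<close>

lemma nc_exp_add:
  assumes comm: "f * g = g * f" and "f $ 0 = 0" "g $ 0 = 0"
  shows "nc_exp (f + g) = nc_exp f * nc_exp g"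
proof (rule fps_ext)
  fix n
  have "(nc_exp f * nc_exp g) $ n
      = (\<Sum>k=0..n. (\<Sum>i\<le>n. exp_term f i $ k) * (\<Sum>j\<le>n. exp_term g j $ (n - k)))"
    unfolding fps_mult_nth
    by (intro sum.cong refl)
      (simp add: nc_exp_nth[OF assms(2), of _ n] nc_exp_nth[OF assms(3), of _ n])
  also have "\<dots> = (\<Sum>i\<le>n. \<Sum>j\<le>n. (exp_term f i * exp_term g j) $ n)"
    unfolding fps_mult_nth sum_product
    by (subst sum.swap) (intro sum.cong refl sum.swap)
  also have "\<dots> = (\<Sum>(i,j)\<in>{..n} \<times> {..n}. (exp_term f i * exp_term g j) $ n)"
    by (simp add: sum.cartesian_product)
  also have "\<dots> = (\<Sum>(i,j)\<in>{(i,j). i + j \<le> n}. (exp_term f i * exp_term g j) $ n)"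
  proof (rule sum.mono_neutral_right)
    have "(exp_term f i * exp_term g j) $ n = 0" if "n < i + j" for i j
      using that by (intro nth_mult_0[of i _ j]) (simp_all add: exp_term_def nth_power_0 assms)
    then show "\<forall>p\<in>{..n} \<times> {..n} - {(i, j). i + j \<le> n}.
        (case p of (i, j) \<Rightarrow> (exp_term f i * exp_term g j) $ n) = 0"
      by clarsimp (metis not_le)
  qed auto
  also have "\<dots> = (\<Sum>k\<le>n. \<Sum>i\<le>k. (exp_term f i * exp_term g (k - i)) $ n)"
    by (rule sum.triangle_reindex_eq)
  also have "\<dots> = nc_exp (f + g) $ n"
    using assms by (simp add: nc_exp_nth[of _ n n] exp_term_add[OF comm] fps_sum_nth)
  finally show "nc_exp (f + g) $ n = (nc_exp f * nc_exp g) $ n" by simp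
qed

section \<open>The real power series \<open>(1 - 2 t)^(-r)\<close>\<close>

text \<open>
  The series \<open>-ln (1 - 2 t)\<close>, so that \<open>\<sigma>_L\<close> and \<open>\<sigma>_R\<close> are its values at \<open>h J\<close> and \<open>h K\<close>.
\<close>

definition neg_log :: "real fps" where
  "neg_log = - (fps_ln 1 oo (- (2 * fps_X)))"

text \<open>
  This is \<open>(1 - 2 t)^(-r)\<close>, introduced as \<open>e^(-r ln (1 - 2 t))\<close>.
\<close>

definition inv_power :: "real \<Rightarrow> real fps" where
  "inv_power r = fps_exp 1 oo (fps_const r * neg_log)"

lemma fps_eq_1I:
  fixes F :: "real fps"
  assumes "fps_deriv F = 0" "F $ 0 = 1"
  shows "F = 1"
  using assms by (simp add: fps_deriv_eq_0_iff)

lemma neg_log_nth_0 [simp]: "neg_log $ 0 = 0"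
  by (simp add: neg_log_def fps_ln_def)

lemma deriv_neg_log: "fps_deriv neg_log * (1 - 2 * fps_X) = 2"
proof -
  let ?Y = "- (2 * fps_X) :: real fps"
  have Y: "?Y $ 0 = 0" by simp
  have Y': "fps_deriv ?Y = - 2" by (simp add: fps_numeral_fps_const)
  have d: "fps_deriv neg_log = 2 * (inverse (1 + fps_X) oo ?Y)"
    using Y by (simp add: neg_log_def fps_compose_deriv fps_ln_deriv Y' mult.commute)
  have 1: "1 - 2 * fps_X = (1 + fps_X) oo ?Y"
    by (simp add: fps_compose_add_distrib)
  have "(inverse (1 + fps_X) oo ?Y) * ((1 + fps_X) oo ?Y) = (1::real fps)"
    unfolding fps_compose_mult_distrib[OF Y, symmetric] by (simp add: inverse_mult_eq_1)
  then show ?thesis by (simp add: d 1 mult.assoc)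
qed

lemma inv_power_nth_0 [simp]: "inv_power r $ 0 = 1"
  by (simp add: inv_power_def)

lemma deriv_inv_power: "fps_deriv (inv_power r) = fps_const r * fps_deriv neg_log * inv_power r"
  by (simp add: inv_power_def fps_compose_deriv mult_ac)

lemma inv_power_mult_uminus: "inv_power r * inv_power (- r) = 1"
  by (rule fps_eq_1I) (simp_all add: deriv_inv_power algebra_simps flip: fps_const_neg)

text \<open>
  The derivative vanishes because \<open>F = (1 - 2 t)^(-1/2)\<close> solves \<open>(1 - 2 t) F' = F\<close>.
\<close>

lemma square_inv_power_half: "inv_power (1/2) ^ 2 * (1 - 2 * fps_X) = 1"
proof (rule fps_eq_1I)
  have h: "2 * fps_const (1/2) = (1 :: real fps)"
    by (simp add: fps_numeral_fps_const)
  have M: "fps_deriv (1 - 2 * fps_X :: real fps) = - 2"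
    by (simp add: fps_numeral_fps_const)
  have "fps_deriv (inv_power (1/2) ^ 2 * (1 - 2 * fps_X))
     = (2 * fps_const (1/2)) * inv_power (1/2) ^ 2 * (fps_deriv neg_log * (1 - 2 * fps_X))
       - 2 * inv_power (1/2) ^ 2"
    by (simp add: power2_eq_square deriv_inv_power M)
  then show "fps_deriv (inv_power (1/2) ^ 2 * (1 - 2 * fps_X)) = 0"
    by (simp add: deriv_neg_log h)
qed (simp add: power2_eq_square)

text \<open>
  Both sides are \<open>1 / (1 - 2 t)\<close>. Expressing it as a power of \<open>(1 - 2 t)^(-1/2)\<close> makes the derivatives
  below monomials in that one series.
\<close>

lemma deriv_neg_log_eq: "fps_const (1/2) * fps_deriv neg_log = inv_power (1/2) ^ 2"
proof -
  have h: "fps_const (1/2) * 2 = (1 :: real fps)"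
    by (simp add: fps_numeral_fps_const)
  have "fps_const (1/2) * fps_deriv neg_log
     = fps_const (1/2) * (fps_deriv neg_log * (1 - 2 * fps_X)) * inv_power (1/2) ^ 2"
    using square_inv_power_half by (simp add: mult_ac)
  then show ?thesis by (simp add: deriv_neg_log h)
qed

lemma deriv_inverse_sqrt: "fps_deriv (inv_power (1/2)) = inv_power (1/2) ^ 3"
  unfolding deriv_inv_power deriv_neg_log_eq by (simp add: power3_eq_cube power2_eq_square)

lemma deriv_sqrt: "fps_deriv (inv_power (- (1/2))) = - inv_power (1/2)"
proof -
  have "fps_deriv (inv_power (- (1/2)))
      = - (fps_const (1/2) * fps_deriv neg_log) * inv_power (- (1/2))"
    unfolding deriv_inv_power by (simp del: fps_const_neg add: fps_const_neg[of "1/2", symmetric])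
  also have "\<dots> = - inv_power (1/2) * (inv_power (1/2) * inv_power (- (1/2)))"
    unfolding deriv_neg_log_eq by (simp add: power2_eq_square mult.assoc)
  finally show ?thesis unfolding inv_power_mult_uminus by simp
qed

section \<open>Two commuting copies of \<open>gl(2)\<close>\<close>

lemma boson_relations:
  assumes "boson_operators cr an" "i \<in> {1,2}" "j \<in> {1,2}" "k \<in> {1,2}" "l \<in> {1,2}"
  shows "an i j * cr k l = cr k l * an i j + of_bool (i = k \<and> j = l)"
    and "cr i j * cr k l = cr k l * cr i j"
    and "an i j * an k l = an k l * an i j"
proof -
  have "commutator (an i j) (cr k l) = of_bool (i = k) * of_bool (j = l) \<and>
        commutator (cr i j) (cr k l) = 0 \<and> commutator (an i j) (an k l) = 0"
    using assms unfolding boson_operators_def by blast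
  then show "an i j * cr k l = cr k l * an i j + of_bool (i = k \<and> j = l)"
    and "cr i j * cr k l = cr k l * cr i j" and "an i j * an k l = an k l * an i j"
    by (auto simp: commutator_def algebra_simps)
qed

lemma commutator_mult_right: "commutator (p::'b::ring_1) (q * r) = commutator p q * r + q * commutator p r"
  by (simp add: commutator_def algebra_simps)

lemma commutator_mult_left: "commutator ((p::'b::ring_1) * q) r = p * commutator q r + commutator p r * q"
  by (simp add: commutator_def algebra_simps)

lemma commutator_add_right: "commutator (p::'b::ring_1) (q + r) = commutator p q + commutator p r"
  by (simp add: commutator_def algebra_simps)

lemma commutator_add_left: "commutator ((p::'b::ring_1) + q) r = commutator p r + commutator q r"
  by (simp add: commutator_def algebra_simps)

text \<open>
  The creation operators form the vector representation of \<open>gl(2)\<close> in either index: \<open>E_lower\<close>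
  moves the lower index and ignores the upper one, \<open>E_upper\<close> does the opposite. The annihilation
  operators transform dually.
\<close>

lemma commutator_E:
  assumes b: "boson_operators cr an" and "i \<in> {1,2}" "j \<in> {1,2}" "k \<in> {1,2}" "l \<in> {1,2}"
  shows "commutator (E_lower cr an i j) (cr k l) = of_bool (j = k) * cr i l" (is ?A)
    and "commutator (E_lower cr an i j) (an k l) = - of_bool (i = k) * an j l" (is ?B)
    and "commutator (E_upper cr an i j) (cr k l) = of_bool (j = l) * cr k i" (is ?C)
proof -
  have *: "commutator (an i j) (cr k l) = of_bool (i = k) * of_bool (j = l)"
    "commutator (cr i j) (an k l) = - (of_bool (i = k) * of_bool (j = l))"
    "commutator (cr i j) (cr k l) = 0" "commutator (an i j) (an k l) = 0"
    if "i \<in> {1,2}" "j \<in> {1,2}" "k \<in> {1,2}" "l \<in> {1,2}" for i j k l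
    using boson_relations[OF b that] boson_relations[OF b that(3,4,1,2)]
    by (auto simp: commutator_def)
  have one: "(1::nat) \<in> {1,2}" "(2::nat) \<in> {1,2}" by auto
  have l: "l = 1 \<or> l = 2" and k: "k = 1 \<or> k = 2" using assms by auto
  show ?A ?B ?C using k l
    unfolding E_lower_def E_upper_def commutator_mult_left commutator_add_left
    by (auto simp del: One_nat_def insert_iff simp add: assms one *)
qed

text \<open>
  Since \<open>E_lower\<close> acts as a derivation, it annihilates the contraction over lower indices that
  defines \<open>E_upper\<close>: the vector and the dual contribution cancel.
\<close>

lemma commutator_E_lower_E_upper:
  assumes b: "boson_operators cr an" and "i \<in> {1,2}" "j \<in> {1,2}" "k \<in> {1,2}" "l \<in> {1,2}"
  shows "commutator (E_lower cr an i j) (E_upper cr an k l) = 0"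
proof -
  have one: "(1::nat) \<in> {1,2}" "(2::nat) \<in> {1,2}" by auto
  have l: "i = 1 \<or> i = 2" and k: "j = 1 \<or> j = 2" using assms by auto
  then show ?thesis
    unfolding E_upper_def[of cr an k l] commutator_mult_right commutator_add_right
    by (auto simp del: One_nat_def insert_iff simp add: assms one commutator_E)
qed

lemma Z_L_eq: "Z_L cr an = - Z_R cr an"
  by (simp add: Z_L_def Z_R_def E_lower_def E_upper_def)

lemma commutator_zero_iff: "commutator p q = 0 \<longleftrightarrow> p * q = q * p"
  by (simp add: commutator_def)

lemma J_plus_K_plus_commute:
  assumes "boson_operators cr an"
  shows "J_plus cr an * K_plus cr an = K_plus cr an * J_plus cr an"
  using commutator_E_lower_E_upper[OF assms, of 2 1 1 2]
  by (simp add: J_plus_def K_plus_def commutator_zero_iff)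

text \<open>
  The number operator is the trace of either copy of \<open>gl(2)\<close>, so it commutes with the other copy:
  its form \<open>Z_R\<close> is used for \<open>J_+\<close>, and its form \<open>- Z_L\<close> for \<open>K_+\<close>.
\<close>

lemma Z_R_commute:
  assumes "boson_operators cr an"
  shows "J_plus cr an * Z_R cr an = Z_R cr an * J_plus cr an"
    and "K_plus cr an * Z_R cr an = Z_R cr an * K_plus cr an"
proof -
  have "commutator (J_plus cr an) (Z_R cr an) = 0"
    by (simp add: J_plus_def Z_R_def commutator_add_right commutator_E_lower_E_upper[OF assms])
  then show "J_plus cr an * Z_R cr an = Z_R cr an * J_plus cr an"
    by (simp add: commutator_zero_iff)
  have Z: "Z_R cr an = E_lower cr an 1 1 + E_lower cr an 2 2"
    using Z_L_eq[of cr an] by (simp add: Z_L_def algebra_simps)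
  have "commutator (Z_R cr an) (K_plus cr an) = 0"
    by (simp add: K_plus_def Z commutator_add_left commutator_E_lower_E_upper[OF assms])
  then show "K_plus cr an * Z_R cr an = Z_R cr an * K_plus cr an"
    by (simp add: commutator_zero_iff)
qed

lemma action_on_creators:
  assumes b: "boson_operators cr an" and k: "k \<in> {1,2}" and l: "l \<in> {1,2}"
  shows "J_plus cr an * cr k l = cr k l * J_plus cr an + of_bool (k = 1) * cr 2 l"
    and "K_plus cr an * cr k l = cr k l * K_plus cr an + of_bool (l = 2) * cr k 1"
    and "Z_R cr an * cr k l = cr k l * Z_R cr an + cr k l"
proof -
  have "commutator (J_plus cr an) (cr k l) = of_bool (k = 1) * cr 2 l"
    using commutator_E(1)[OF b _ _ k l, of 2 1] by (auto simp: J_plus_def)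
  then show "J_plus cr an * cr k l = cr k l * J_plus cr an + of_bool (k = 1) * cr 2 l"
    by (simp add: commutator_def algebra_simps)
  have "commutator (K_plus cr an) (cr k l) = of_bool (l = 2) * cr k 1"
    using commutator_E(3)[OF b _ _ k l, of 1 2] by (auto simp: K_plus_def)
  then show "K_plus cr an * cr k l = cr k l * K_plus cr an + of_bool (l = 2) * cr k 1"
    by (simp add: commutator_def algebra_simps)
  have "commutator (Z_R cr an) (cr k l) = cr k l"
    using l commutator_E(3)[OF b _ _ k l, of 1 1] commutator_E(3)[OF b _ _ k l, of 2 2]
    by (auto simp: Z_R_def commutator_add_left)
  then show "Z_R cr an * cr k l = cr k l * Z_R cr an + cr k l"
    by (simp add: commutator_def algebra_simps)
qed

section \<open>The Jordanian relations of the dressed operators\<close>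

text \<open>
  The quantum determinant of the two-parametric Jordanian deformation, whose correction term depends
  on \<open>h\<close> and \<open>g\<close> only through \<open>s = h + g\<close>.
\<close>

definition jordanian_det :: "'b::ring_1 \<Rightarrow> 'b \<Rightarrow> 'b \<Rightarrow> 'b \<Rightarrow> 'b \<Rightarrow> 'b" where
  "jordanian_det s a b c d = a * d - b * c - s * a * c"

definition jordanian_relations :: "'b::ring_1 \<Rightarrow> 'b \<Rightarrow> 'b \<Rightarrow> 'b \<Rightarrow> 'b \<Rightarrow> 'b \<Rightarrow> bool" where
  "jordanian_relations h g a b c d \<longleftrightarrow>
     commutator a b = - (h + g) * (jordanian_det (h + g) a b c d - a ^ 2) \<and>
     commutator a c = - (h - g) * c ^ 2 \<and>
     commutator a d = (h + g) * a * c - (h - g) * d * c \<and>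
     commutator b c = - (h + g) * a * c - (h - g) * c * d \<and>
     commutator b d = (h - g) * (jordanian_det (h + g) a b c d - d ^ 2) \<and>
     commutator c d = (h + g) * c ^ 2"

text \<open>
  Here \<open>P'\<close> and \<open>Q'\<close> are the inverses of \<open>P\<close> and \<open>Q\<close>. The exchange relations are used as rewrite
  rules that move \<open>P, P', Q, Q'\<close> to the right of the commuting \<open>Aij\<close>; the rules terminate, because
  each correction term replaces \<open>A1j\<close> by \<open>A2j\<close> or \<open>Ai2\<close> by \<open>Ai1\<close>, and such a replacement can
  happen only once per index.
\<close>

lemma jordanian_relations_dressed:
  fixes A11 A12 A21 A22 P P' Q Q' h x u v y :: "'b::ring_1"
  assumes h: "\<And>z. z * h = h * z"
    and comm: "A12 * A11 = A11 * A12" "A21 * A11 = A11 * A21" "A22 * A11 = A11 * A22"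
       "A21 * A12 = A12 * A21" "A22 * A12 = A12 * A22" "A22 * A21 = A21 * A22"
    and inv: "P * P' = 1" "P' * P = 1" "Q * Q' = 1" "Q' * Q = 1"
    and PQ: "Q * P = P * Q" "Q' * P = P * Q'" "Q * P' = P' * Q" "Q' * P' = P' * Q'"
    and P: "P * A21 = A21 * P" "P * A22 = A22 * P" "P' * A21 = A21 * P'" "P' * A22 = A22 * P'"
      "P * A11 = A11 * P + h * P ^ 3 * A21" "P * A12 = A12 * P + h * P ^ 3 * A22"
      "P' * A11 = A11 * P' - h * P * A21" "P' * A12 = A12 * P' - h * P * A22"
    and Q: "Q * A11 = A11 * Q" "Q * A21 = A21 * Q" "Q' * A11 = A11 * Q'" "Q' * A21 = A21 * Q'"
      "Q * A12 = A12 * Q + h * Q ^ 3 * A11" "Q * A22 = A22 * Q + h * Q ^ 3 * A21"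
      "Q' * A12 = A12 * Q' - h * Q * A11" "Q' * A22 = A22 * Q' - h * Q * A21"
    and x: "x = A11 * P' * Q" and u: "u = A12 * P' * Q'"
    and v: "v = A21 * P * Q" and y: "y = A22 * P * Q'"
  shows "jordanian_relations h 0 x u v y"
proof -
  have r': "p * (q * w) = s * w" if "p * q = s" for p q s w :: 'b
    using that by (simp flip: mult.assoc)
  note central = h[of A11] h[of A12] h[of A21] h[of A22] h[of P] h[of Q] h[of P'] h[of Q']
  note r = comm inv PQ P Q central
  note normal_order = r r[THEN r'] x u v y algebra_simps power3_eq_cube
  have D: "jordanian_det h x u v y = A11 * A22 - A12 * A21"
    by (simp add: jordanian_det_def normal_order)
  show ?thesis
    unfolding jordanian_relations_def add_0_right diff_0_right D
    by (intro conjI) (simp_all add: commutator_def power2_eq_square normal_order)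
qed

text \<open>
  The relations with \<open>g = 0\<close> and the grading by \<open>N\<close> are used as rewrite rules that bring every word
  into the order \<open>x, u, v, y, N\<close>, with the central \<open>h\<close> and \<open>g\<close> in front. Once both sides of a relation
  are sums of ordered words, they agree word by word.
\<close>

lemma jordanian_relations_twist:
  fixes x u v y N h g :: "'b::ring_1"
  assumes rel: "jordanian_relations h 0 x u v y"
    and h: "\<And>z. z * h = h * z" and g: "\<And>z. z * g = g * z"
    and N: "N * x = x * N + x" "N * u = u * N + u" "N * v = v * N + v" "N * y = y * N + y"
    and a: "a = x + g * v * N"
    and b: "b = u - g * x * N + g * y * N - g ^ 2 * v * N * N"
    and d: "d = y - g * v * N"
  shows "jordanian_relations h g a b v d"
proof -
  define D where "D = x * y - u * v - h * (x * v)"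
  have "jordanian_det h x u v y = D"
    by (simp add: jordanian_det_def D_def mult.assoc)
  then have C: "commutator x u = - h * (D - x * x)" "commutator u y = h * (D - y * y)"
    "commutator x y = h * (x * v) - h * (y * v)" "commutator v y = h * (v * v)"
    "commutator x v = - h * (v * v)" "commutator u v = - h * (x * v) - h * (v * y)"
    using rel by (simp_all add: jordanian_relations_def power2_eq_square mult.assoc)
  have swap: "q * p = p * q - commutator p q" for p q :: 'b
    by (simp add: commutator_def)
  have relations: "u * x = x * u + h * (D - x * x)" "y * u = u * y - h * (D - y * y)"
    "y * x = x * y - h * (x * v) + h * (y * v)" "y * v = v * y - h * (v * v)"
    "v * x = x * v + h * (v * v)" "v * u = u * v + h * (x * v) + h * (v * y)"
    by (simp_all add: swap[of u x] swap[of y u] swap[of y x] swap[of y v] swap[of v x]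
        swap[of v u] C)
  have r': "p * (q * w) = s * w" if "p * q = s" for p q s w :: 'b
    using that by (simp flip: mult.assoc)
  note r = relations N
  note central = g[of x] g[of u] g[of v] g[of y] g[of N]
    h[of x] h[of u] h[of v] h[of y] h[of N] h[of g]
  note normal_order = r r[THEN r'] central central[THEN r'] D_def
  show ?thesis
    unfolding jordanian_relations_def
    by (intro conjI)
      (simp_all add: commutator_def jordanian_det_def power2_eq_square a b d algebra_simps
        normal_order)
qed

section \<open>The boson realization\<close>

lemma neg_nc_ln_eq: "- nc_ln (1 - 2 * fps_X * fps_const J) = series_at J neg_log"
proof -
  have "(1 - 2 * fps_X * fps_const J) - 1 = series_at J (- (2 * fps_X))"
    by (rule fps_ext) (auto simp: fps_numeral_fps_const mult.assoc fps_X_def)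
  then show ?thesis
    unfolding nc_ln_def by (simp only: compose_series_at) (simp only: neg_log_def series_at_minus)
qed

lemma nc_exp_series_at: "nc_exp (series_at J (fps_const r * neg_log)) = series_at J (inv_power r)"
  by (simp add: nc_exp_def compose_series_at inv_power_def)

lemma nc_exp_dressing:
  assumes "boson_operators cr an"
    and "f = series_at (J_plus cr an) (fps_const r * neg_log)
      + series_at (K_plus cr an) (fps_const s * neg_log)"
  shows "nc_exp f = series_at (J_plus cr an) (inv_power r) * series_at (K_plus cr an) (inv_power s)"
  unfolding assms(2) nc_exp_series_at[symmetric]
  by (rule nc_exp_add) (simp_all add: series_at_commute[OF J_plus_K_plus_commute[OF assms(1)]])

text \<open>
  The value of \<open>inv_power r\<close> at \<open>h J\<close> is \<open>e^(r \<sigma>_L)\<close>, and at \<open>h K\<close> it is \<open>e^(r \<sigma>_R)\<close>; the exponential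
  of the half sums and half differences splits because \<open>\<sigma>_L\<close> and \<open>\<sigma>_R\<close> commute.
\<close>

lemma dressed_operators:
  assumes "boson_operators cr an"
  defines "P \<equiv> \<lambda>r. series_at (J_plus cr an) (inv_power r)"
    and "Q \<equiv> \<lambda>r. series_at (K_plus cr an) (inv_power r)"
  shows "x_op cr an = fps_const (cr 1 1) * P (- (1/2)) * Q (1/2)"
    and "u_op cr an = fps_const (cr 1 2) * P (- (1/2)) * Q (- (1/2))"
    and "v_op cr an = fps_const (cr 2 1) * P (1/2) * Q (1/2)"
    and "y_op cr an = fps_const (cr 2 2) * P (1/2) * Q (- (1/2))"
proof -
  have scale: "series_at J (fps_const (- (1/2)) * F) = - half (series_at J F)"
    "series_at J (fps_const (1/2) * F) = half (series_at J F)" for J :: 'a and F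
    by (rule fps_ext, simp add: half_def mult.assoc[symmetric] flip: of_real_mult)+
  have half: "half (f + g) = half f + half g" "half (f - g) = half f - half g"
    "half (- f) = - half f" for f g :: "'a fps"
    by (simp_all add: half_def algebra_simps)
  have sigma: "sigma_L cr an = series_at (J_plus cr an) neg_log"
    "sigma_R cr an = series_at (K_plus cr an) neg_log"
    by (simp_all only: sigma_L_def sigma_R_def neg_nc_ln_eq)
  note S = sigma scale half P_def Q_def mult.assoc
  show "x_op cr an = fps_const (cr 1 1) * P (- (1/2)) * Q (1/2)"
    by (simp add: x_op_def S nc_exp_dressing[OF assms(1), of _ "- (1/2)" "1/2"])
  show "u_op cr an = fps_const (cr 1 2) * P (- (1/2)) * Q (- (1/2))"
    by (simp add: u_op_def S nc_exp_dressing[OF assms(1), of _ "- (1/2)" "- (1/2)"])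
  show "v_op cr an = fps_const (cr 2 1) * P (1/2) * Q (1/2)"
    by (simp add: v_op_def S nc_exp_dressing[OF assms(1), of _ "1/2" "1/2"])
  show "y_op cr an = fps_const (cr 2 2) * P (1/2) * Q (- (1/2))"
    by (simp add: y_op_def S nc_exp_dressing[OF assms(1), of _ "1/2" "- (1/2)"])
qed

lemma jordanian_relations_xuvy:
  assumes b: "boson_operators cr an"
  shows "jordanian_relations fps_X 0 (x_op cr an) (u_op cr an) (v_op cr an) (y_op cr an)"
proof -
  let ?J = "J_plus cr an" and ?K = "K_plus cr an"
  let ?P = "\<lambda>r. series_at ?J (inv_power r)" and ?Q = "\<lambda>r. series_at ?K (inv_power r)"
  have one: "(1::nat) \<in> {1,2}" "(2::nat) \<in> {1,2}" by auto
  note act = action_on_creators[OF b one(1) one(1)] action_on_creators[OF b one(1) one(2)]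
    action_on_creators[OF b one(2) one(1)] action_on_creators[OF b one(2) one(2)]
  have inv: "series_at J (inv_power (1/2)) * series_at J (inv_power (- (1/2))) = 1"
    "series_at J (inv_power (- (1/2))) * series_at J (inv_power (1/2)) = 1" for J :: 'a
    using inv_power_mult_uminus[of "1/2"] inv_power_mult_uminus[of "- (1/2)"]
    by (simp_all flip: series_at_mult)
  have exchange: "series_at J (inv_power (1/2)) * fps_const A
      = fps_const A * series_at J (inv_power (1/2))
        + fps_X * series_at J (inv_power (1/2)) ^ 3 * fps_const B"
    "series_at J (inv_power (- (1/2))) * fps_const A
      = fps_const A * series_at J (inv_power (- (1/2)))
        - fps_X * series_at J (inv_power (1/2)) * fps_const B"
    if "J * A = A * J + B" "J * B = B * J" for J A B :: 'a
    using series_at_commutator[OF that, of "inv_power (1/2)"]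
      series_at_commutator[OF that, of "inv_power (- (1/2))"]
    by (simp_all add: deriv_inverse_sqrt deriv_sqrt series_at_power series_at_minus)
  have cr: "fps_const (cr i j) * fps_const (cr k l) = fps_const (cr k l) * fps_const (cr i j)"
    if "i \<in> {1,2}" "j \<in> {1,2}" "k \<in> {1,2}" "l \<in> {1,2}" for i j k l
    using boson_relations(2)[OF b that] by simp
  note KJ = series_at_commute[OF J_plus_K_plus_commute[OF b], symmetric]
  show ?thesis
  proof (rule jordanian_relations_dressed[where P = "?P (1/2)" and P' = "?P (- (1/2))"
        and Q = "?Q (1/2)" and Q' = "?Q (- (1/2))"])
    show "z * fps_X = fps_X * z" for z :: "'a fps"
      by (rule fps_mult_fps_X_commute[symmetric])
  qed (rule dressed_operators[OF b] inv KJ cr one exchange series_at_const_commute |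
      use act in \<open>simp; fail\<close>)+
qed

text \<open>
  The dressing factors commute with the number operator, so a dressed creation operator still raises
  the number by one.
\<close>

lemma number_grading:
  assumes b: "boson_operators cr an" and k: "k \<in> {1,2}" "l \<in> {1,2}"
  shows "fps_const (Z_R cr an)
      * (fps_const (cr k l) * series_at (J_plus cr an) F * series_at (K_plus cr an) G)
    = fps_const (cr k l) * series_at (J_plus cr an) F * series_at (K_plus cr an) G
        * fps_const (Z_R cr an)
      + fps_const (cr k l) * series_at (J_plus cr an) F * series_at (K_plus cr an) G"
  (is "?Z * (?A * ?F * ?G) = _")
proof -
  have A: "?Z * ?A = ?A * ?Z + ?A"
    by (simp add: action_on_creators(3)[OF b k])
  have F: "?F * ?Z = ?Z * ?F" and G: "?G * ?Z = ?Z * ?G"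
    by (intro series_at_const_commute Z_R_commute[OF b])+
  have "?Z * (?A * ?F * ?G) = ?A * (?Z * ?F) * ?G + ?A * ?F * ?G"
    by (simp only: mult.assoc[symmetric] A distrib_right)
  also have "?A * (?Z * ?F) * ?G = ?A * ?F * (?Z * ?G)"
    by (simp only: F[symmetric] mult.assoc)
  finally show ?thesis
    by (simp only: G[symmetric] mult.assoc)
qed

theorem proposition6p1:
  fixes cr an :: "nat \<Rightarrow> nat \<Rightarrow> 'a::real_algebra_1"
    and h g x u v y ZL ZR a b c d D' :: "'a fps"
  assumes bosons: "boson_operators cr an"
    and h: "h = fps_X"
    and g_central: "\<forall>f. g * f = f * g"
    and x: "x = x_op cr an"
    and u: "u = u_op cr an"
    and v: "v = v_op cr an"
    and y: "y = y_op cr an"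
    and ZL: "ZL = fps_const (Z_L cr an)"
    and ZR: "ZR = fps_const (Z_R cr an)"
    and a: "a = x - g * v * ZL"
    and b: "b = u - g * x * ZR - g * y * ZL + g ^ 2 * v * ZL * ZR"
    and c: "c = v"
    and d: "d = y - g * v * ZR"
    and D': "D' = a * d - b * c - (h + g) * a * c"
  shows "commutator a b = - (h + g) * (D' - a ^ 2)
    \<and> commutator a c = - (h - g) * c ^ 2
    \<and> commutator a d = (h + g) * a * c - (h - g) * d * c
    \<and> commutator b c = - (h + g) * a * c - (h - g) * c * d
    \<and> commutator b d = (h - g) * (D' - d ^ 2)
    \<and> commutator c d = (h + g) * c ^ 2"
proof -
  let ?N = "fps_const (Z_R cr an)"
  have one: "(1::nat) \<in> {1,2}" "(2::nat) \<in> {1,2}" by auto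
  have ZL': "ZL = - ?N"
    by (simp add: ZL Z_L_eq)
  have "jordanian_relations h g a b v d"
  proof (rule jordanian_relations_twist)
    show "jordanian_relations h 0 x u v y"
      unfolding h x u v y by (rule jordanian_relations_xuvy[OF bosons])
    show "z * h = h * z" for z
      unfolding h by (rule fps_mult_fps_X_commute[symmetric])
    show "z * g = g * z" for z
      using g_central by simp
    show "?N * x = x * ?N + x" "?N * u = u * ?N + u" "?N * v = v * ?N + v" "?N * y = y * ?N + y"
      unfolding x u v y dressed_operators[OF bosons] by (intro number_grading bosons one)+
    show "a = x + g * v * ?N" "b = u - g * x * ?N + g * y * ?N - g ^ 2 * v * ?N * ?N"
      "d = y - g * v * ?N"
      by (simp_all add: a b d ZL' ZR del: fps_const_neg)
  qed
  then show ?thesis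
    unfolding D' c jordanian_relations_def jordanian_det_def by blast
qed

end
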